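(* Let $(X,\mathbb{F})$ and $(Y,\mathbb{G})$ be non-autonomous dynamical systems generated by $\mathbb{F}=\{f_n:n\in\mathbb{N}\}$ and $\mathbb{G}=\{g_n:n\in\mathbb{N}\}$ respectively, such that $(g_n)$ converges uniformly to a map $g$. If $(x_1,x_2)\in L(X,\mathbb{F})$ and $(y_1,y_2)\in L(Y,\mathbb{G})$, then for every $\epsilon>0$ there exists a syndetic set $A\subseteq\mathbb{N}$ such that $d_X(\omega_{k,X}(x_1),\omega_{k,X}(x_2))<\epsilon$ and $d_Y(\omega_{k,Y}(y_1),\omega_{k,Y}(y_2))<\epsilon$ for all $k\in A$.
   Context: A non-autonomous system $(X,\mathbb{F})$ consists of a compact metric space $(X,d_X)$ and a sequence $\mathbb{F}=(f_n)_{n\ge 1}$ of surjective continuous self-maps of $X$; $\omega_{k,X}=f_k\circ\cdots\circ f_1$. Likewise for $(Y,\mathbb{G})$, with metric $d_Y$ and $\omega_{k,Y}=g_k\circ\cdots\circ g_1$. A set $S=\{s_n:n\in\mathbb{N}\}\subseteq\mathbb{N}$ (with $s_1<s_2<\cdots$) is syndetic if there is $M\in\mathbb{N}$ with $|s_{n+1}-s_n|\le M$ for all $n$. $L(X,\mathbb{F})$ is the set of syndetically proximal pairs: pairs $(x,y)\in X\times X$ such that for every $\epsilon>0$ the set $\{n\in\mathbb{N}: d_X(\omega_{n,X}(x),\omega_{n,X}(y))<\epsilon\}$ is syndetic. $L(Y,\mathbb{G})$ is defined in the same way. *)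

theory Defs
  imports "HOL-Analysis.Analysis"
begin

text \<open>
  The time set is \<open>{1, 2, \<dots>}\<close>. A sequence of self-maps is a function on
  \<^typ>\<open>nat\<close> whose value at index \<open>0\<close> is never used. The compact metric space is
  a compact set \<open>X\<close> in a type of class \<^class>\<open>metric_space\<close>, with metric
  \<^const>\<open>dist\<close> restricted to \<open>X\<close>.
\<close>

definition nonautonomous_system :: "'a::metric_space set \<Rightarrow> (nat \<Rightarrow> 'a \<Rightarrow> 'a) \<Rightarrow> bool" where
  "nonautonomous_system X f \<longleftrightarrow>
     compact X \<and> (\<forall>n\<ge>1. continuous_on X (f n) \<and> f n ` X = X)"

text \<open>\<open>omega f k = f k \<circ> \<dots> \<circ> f 1\<close>\<close>

primrec omega :: "(nat \<Rightarrow> 'a \<Rightarrow> 'a) \<Rightarrow> nat \<Rightarrow> 'a \<Rightarrow> 'a" where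
  "omega f 0 = id"
| "omega f (Suc k) = f (Suc k) \<circ> omega f k"

text \<open>
  The enumeration \<open>s\<close> is indexed from \<open>0\<close> instead of \<open>1\<close>. A syndetic set is
  infinite. The truncated subtraction is harmless because \<open>s\<close> is increasing.
\<close>

definition syndetic :: "nat set \<Rightarrow> bool" where
  "syndetic S \<longleftrightarrow> S \<subseteq> {1..} \<and>
     (\<exists>s. strict_mono s \<and> S = range s \<and> (\<exists>M. \<forall>n. s (Suc n) - s n \<le> M))"

definition syndetically_proximal_pairs ::
    "'a::metric_space set \<Rightarrow> (nat \<Rightarrow> 'a \<Rightarrow> 'a) \<Rightarrow> ('a \<times> 'a) set" where
  "syndetically_proximal_pairs X f =
     {(x, y) \<in> X \<times> X. \<forall>\<epsilon>>0. syndetic {n. n \<ge> 1 \<and> dist (omega f n x) (omega f n y) < \<epsilon>}}"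

end

theory Submission
  imports Defs
begin

text \<open>
  A uniformly convergent sequence of continuous maps of a compact space is
  equicontinuous. So if two orbits in \<open>Y\<close> are close enough at time \<open>n\<close>, they stay
  \<open>\<epsilon>\<close>-close during the next \<open>M\<close> steps, where \<open>M\<close> bounds the gaps of the set of times at
  which the orbits in \<open>X\<close> are \<open>\<epsilon>\<close>-close. That window contains such a time, and windows
  of this kind recur syndetically.
\<close>

text \<open>Replaces the increasing enumeration by a window condition: two such conditions combine
  by adding their window lengths, with no indices to track.\<close>

lemma syndetic_iff:
  "syndetic S \<longleftrightarrow> S \<subseteq> {1..} \<and> (\<exists>M. \<forall>n. \<exists>s\<in>S. n < s \<and> s \<le> n + M)"
proof
  assume "syndetic S"
  then obtain s M where S: "S \<subseteq> {1..}" "strict_mono s" "S = range s"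
    and gap: "\<And>n. s (Suc n) - s n \<le> M"
    unfolding syndetic_def by blast
  \<comment> \<open>The gap bound says nothing about the stretch before the first element, so
    \<open>s 0\<close> is added to the window length.\<close>
  have "\<exists>i. n < s i \<and> s i \<le> n + (M + s 0)" for n
  proof (induction n)
    case 0
    have "0 < s 0" using S by fastforce
    then show ?case by (intro exI[of _ 0]) simp
  next
    case (Suc n)
    then obtain i where i: "n < s i" "s i \<le> n + (M + s 0)" by blast
    \<comment> \<open>The witness for \<open>n\<close> still serves for \<open>Suc n\<close> unless
      it equals \<open>Suc n\<close>; then the next element of the enumeration does, by the gap
      bound.\<close>
    show ?case
    proof (cases "s i = Suc n")
      case True
      moreover have "s i < s (Suc i)" using S by (simp add: strict_mono_Suc_iff)
      ultimately show ?thesis using gap[of i] by (intro exI[of _ "Suc i"]) linarith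
    next
      case False
      with i show ?thesis by (intro exI[of _ i]) linarith
    qed
  qed
  then show "S \<subseteq> {1..} \<and> (\<exists>M. \<forall>n. \<exists>s\<in>S. n < s \<and> s \<le> n + M)"
    using S by blast
next
  assume *: "S \<subseteq> {1..} \<and> (\<exists>M. \<forall>n. \<exists>s\<in>S. n < s \<and> s \<le> n + M)"
  then obtain M where M: "\<And>n. \<exists>s\<in>S. n < s \<and> s \<le> n + M" by blast
  then have inf: "infinite S"
    unfolding infinite_nat_iff_unbounded by blast
  have "enumerate S (Suc n) - enumerate S n \<le> M" for n
  proof -
    obtain s where "s \<in> S" "enumerate S n < s" "s \<le> enumerate S n + M" using M by blast
    \<comment> \<open>\<open>enumerate S (Suc n)\<close> is the least element of \<open>S\<close>
      above \<open>enumerate S n\<close>, so any element found in the window bounds it.\<close>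
    moreover from this have "enumerate S (Suc n) \<le> s"
      by (simp add: enumerate_Suc'' inf Least_le)
    ultimately show ?thesis by linarith
  qed
  then show "syndetic S"
    unfolding syndetic_def using * inf range_enumerate[OF inf] strict_mono_enumerate[OF inf]
    by metis
qed

text \<open>The limit \<open>l\<close> is continuous, hence uniformly continuous on the compact
  \<open>Y\<close>. Past some \<open>N\<close> every \<open>g n\<close> is
  \<open>e / 3\<close>-close to \<open>l\<close>, and the triangle inequality transfers the modulus
  of \<open>l\<close>; finitely many indices remain, each with its own modulus.\<close>

lemma uniform_limit_imp_equicontinuous:
  fixes g :: "nat \<Rightarrow> 'b::metric_space \<Rightarrow> 'c::metric_space"
  assumes "compact Y" and cont: "\<And>n. n \<ge> 1 \<Longrightarrow> continuous_on Y (g n)"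
    and lim: "uniform_limit Y g l sequentially" and "e > 0"
  shows "\<exists>d>0. \<forall>n\<ge>1. \<forall>y\<in>Y. \<forall>z\<in>Y. dist y z < d \<longrightarrow> dist (g n y) (g n z) < e"
proof -
  have unif: "\<exists>d>0. \<forall>y\<in>Y. \<forall>z\<in>Y. dist y z < d \<longrightarrow> dist (h y) (h z) < r"
    if "continuous_on Y h" "r > 0" for h :: "'b \<Rightarrow> 'c" and r
    using compact_uniformly_continuous[OF that(1) \<open>compact Y\<close>] \<open>r > 0\<close>
    unfolding uniformly_continuous_on_def by meson
  have "\<forall>\<^sub>F n in sequentially. continuous_on Y (g n)"
    using cont eventually_sequentially by blast
  then have "continuous_on Y l"
    using uniform_limit_theorem lim trivial_limit_sequentially by blast
  then obtain d0 where d0: "d0 > 0"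
    "\<And>y z. \<lbrakk>y \<in> Y; z \<in> Y; dist y z < d0\<rbrakk> \<Longrightarrow> dist (l y) (l z) < e / 3"
    using unif[of l "e / 3"] \<open>e > 0\<close> by auto
  obtain N where N: "\<And>n y. \<lbrakk>n \<ge> N; y \<in> Y\<rbrakk> \<Longrightarrow> dist (g n y) (l y) < e / 3"
    using uniform_limitD[OF lim, of "e / 3"] \<open>e > 0\<close>
    unfolding eventually_sequentially by auto
  have "\<forall>n\<in>{1..N}. \<exists>d>0. \<forall>y\<in>Y. \<forall>z\<in>Y. dist y z < d \<longrightarrow> dist (g n y) (g n z) < e"
    using unif cont \<open>e > 0\<close> by simp
  then obtain D where D: "\<And>n. n \<in> {1..N} \<Longrightarrow> D n > 0"
    "\<And>n y z. \<lbrakk>n \<in> {1..N}; y \<in> Y; z \<in> Y; dist y z < D n\<rbrakk> \<Longrightarrow> dist (g n y) (g n z) < e"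
    by metis
  \<comment> \<open>\<open>d0\<close> serves the indices beyond \<open>N\<close>, the values of
    \<open>D\<close> those up to \<open>N\<close>; \<open>d0\<close> also keeps the set nonempty
    when \<open>N = 0\<close>.\<close>
  define d where "d = Min (insert d0 (D ` {1..N}))"
  have "d > 0" using d0 D unfolding d_def by simp
  moreover have "dist (g n y) (g n z) < e"
    if "n \<ge> 1" "y \<in> Y" "z \<in> Y" "dist y z < d" for n y z
  proof (cases "n \<le> N")
    case True
    with that D show ?thesis by (simp add: d_def)
  next
    case False
    have "dist (l y) (l z) < e / 3" using that d0 by (simp add: d_def)
    moreover have "dist (g n y) (l y) < e / 3" "dist (g n z) (l z) < e / 3"
      using N False that by auto
    ultimately show ?thesis
      by (metis dist_commute dist_triangle_third)
  qed
  ultimately show ?thesis by blast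
qed

lemma omega_mem:
  assumes "nonautonomous_system Y g" "y \<in> Y"
  shows "omega g n y \<in> Y"
  using assms by (induction n) (auto simp: nonautonomous_system_def)

text \<open>Induction on the window length with \<open>e\<close> arbitrary. Equicontinuity gives a
  modulus valid for every map, so \<open>d\<close> does not depend on the starting time
  \<open>n\<close>.\<close>

lemma omega_close_on_window:
  assumes sys: "nonautonomous_system Y g" and lim: "uniform_limit Y g l sequentially"
    and y: "y1 \<in> Y" "y2 \<in> Y" and "e > 0"
  shows "\<exists>d>0. \<forall>n. dist (omega g n y1) (omega g n y2) < d \<longrightarrow>
    (\<forall>j\<le>M. dist (omega g (n + j) y1) (omega g (n + j) y2) < e)"
  using \<open>e > 0\<close>
proof (induction M arbitrary: e)
  case 0
  then show ?case by auto
next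
  case (Suc M)
  obtain r where r: "r > 0"
    "\<And>n y z. \<lbrakk>n \<ge> 1; y \<in> Y; z \<in> Y; dist y z < r\<rbrakk> \<Longrightarrow> dist (g n y) (g n z) < e"
    using uniform_limit_imp_equicontinuous[OF _ _ lim Suc.prems] sys
    unfolding nonautonomous_system_def by meson
  \<comment> \<open>The bound \<open>e\<close> settles the first \<open>M\<close> steps, and
    \<open>r\<close> lets one more map keep the orbits \<open>e\<close>-close.\<close>
  obtain d where d: "d > 0"
    "\<And>n j. \<lbrakk>dist (omega g n y1) (omega g n y2) < d; j \<le> M\<rbrakk> \<Longrightarrow>
      dist (omega g (n + j) y1) (omega g (n + j) y2) < min e r"
    using Suc.IH[of "min e r"] Suc.prems r by auto
  have "dist (omega g (n + j) y1) (omega g (n + j) y2) < e"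
    if "dist (omega g n y1) (omega g n y2) < d" "j \<le> Suc M" for n j
  proof (cases "j \<le> M")
    case True
    with d that show ?thesis by simp
  next
    case False
    then have "j = Suc M" using that by simp
    \<comment> \<open>The map applied last has index \<open>Suc (n + M)\<close>, at least 1 even for
      \<open>n = 0\<close>, so the modulus \<open>r\<close> applies.\<close>
    then show ?thesis using d(2)[OF that(1), of M] r(2) omega_mem[OF sys] y by simp
  qed
  with \<open>d > 0\<close> show ?case by blast
qed

theorem theorem4p1:
  fixes X :: "'a::metric_space set" and f :: "nat \<Rightarrow> 'a \<Rightarrow> 'a"
    and Y :: "'b::metric_space set" and g :: "nat \<Rightarrow> 'b \<Rightarrow> 'b" and g_lim :: "'b \<Rightarrow> 'b"
    and x1 x2 :: 'a and y1 y2 :: 'b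
  assumes "nonautonomous_system X f"
    and "nonautonomous_system Y g"
    and "uniform_limit Y g g_lim sequentially"
    and "(x1, x2) \<in> syndetically_proximal_pairs X f"
    and "(y1, y2) \<in> syndetically_proximal_pairs Y g"
  shows "\<forall>\<epsilon>>0. \<exists>A. syndetic A \<and>
    (\<forall>k\<in>A. dist (omega f k x1) (omega f k x2) < \<epsilon> \<and> dist (omega g k y1) (omega g k y2) < \<epsilon>)"
proof (intro allI impI)
  fix \<epsilon> :: real
  assume "\<epsilon> > 0"
  define A where "A = {k. k \<ge> 1 \<and> dist (omega f k x1) (omega f k x2) < \<epsilon> \<and>
    dist (omega g k y1) (omega g k y2) < \<epsilon>}"
  have y: "y1 \<in> Y" "y2 \<in> Y"
    using assms(5) unfolding syndetically_proximal_pairs_def by auto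
  have "syndetic {n. n \<ge> 1 \<and> dist (omega f n x1) (omega f n x2) < \<epsilon>}"
    using assms(4) \<open>\<epsilon> > 0\<close> unfolding syndetically_proximal_pairs_def by auto
  then obtain M where M: "\<And>n. \<exists>k. dist (omega f k x1) (omega f k x2) < \<epsilon> \<and> n < k \<and> k \<le> n + M"
    unfolding syndetic_iff by blast
  \<comment> \<open>The order of choices matters: \<open>M\<close> comes from the orbits in
    \<open>X\<close>, \<delta> depends on \<open>M\<close>, and \<open>K\<close> below depends on
    \<delta>.\<close>
  obtain \<delta> where \<delta>: "\<delta> > 0"
    "\<And>n j. \<lbrakk>dist (omega g n y1) (omega g n y2) < \<delta>; j \<le> M\<rbrakk> \<Longrightarrow>
      dist (omega g (n + j) y1) (omega g (n + j) y2) < \<epsilon>"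
    using omega_close_on_window[OF assms(2,3) y \<open>\<epsilon> > 0\<close>, of M] by blast
  have "syndetic {n. n \<ge> 1 \<and> dist (omega g n y1) (omega g n y2) < \<delta>}"
    using assms(5) \<open>\<delta> > 0\<close> unfolding syndetically_proximal_pairs_def by auto
  then obtain K where K: "\<And>n. \<exists>m. dist (omega g m y1) (omega g m y2) < \<delta> \<and> n < m \<and> m \<le> n + K"
    unfolding syndetic_iff by blast
  \<comment> \<open>At most \<open>K\<close> steps lead to a time \<open>m\<close> with
    \<delta>-close orbits in \<open>Y\<close>, and at most \<open>M\<close> more to a time
    \<open>k\<close> with close orbits in \<open>X\<close>; since \<open>k - m\<close> is at most
    \<open>M\<close>, those in \<open>Y\<close> are still close at \<open>k\<close>.\<close>
  have "\<exists>k\<in>A. n < k \<and> k \<le> n + (K + M)" for n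
  proof -
    obtain m where m: "dist (omega g m y1) (omega g m y2) < \<delta>" "n < m" "m \<le> n + K"
      using K by blast
    obtain k where k: "dist (omega f k x1) (omega f k x2) < \<epsilon>" "m < k" "k \<le> m + M"
      using M by blast
    have "dist (omega g k y1) (omega g k y2) < \<epsilon>"
      using \<delta>(2)[OF m(1), of "k - m"] k by simp
    then have "k \<in> A" using k by (simp add: A_def)
    with m k show ?thesis by (intro bexI[of _ k]) auto
  qed
  then have "syndetic A"
    unfolding syndetic_iff by (auto simp: A_def)
  then show "\<exists>A. syndetic A \<and> (\<forall>k\<in>A. dist (omega f k x1) (omega f k x2) < \<epsilon> \<and>
      dist (omega g k y1) (omega g k y2) < \<epsilon>)"
    by (intro exI[of _ A]) (simp add: A_def)
qed

end
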